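(* If $k\neq (n-1)/2$ (that is, $K(n,k)$ is not an odd graph), then there is no $2$-neighbour-transitive code with minimum distance $\delta\geq 5$ in the Kneser graph $K(n,k)$.
   Context: Let $\Omega$ be a finite set with $|\Omega|=n$ and $2\leq k\leq (n-1)/2$. The Kneser graph $K(n,k)$ has as vertices the $k$-subsets of $\Omega$, adjacent iff disjoint; its automorphism group is $\mathrm{Sym}(\Omega)$. A code $C$ is a set of vertices with $|C|\geq 2$. Writing $d$ for graph distance, the minimum distance $\delta$ is the least distance between distinct codewords. For $i\geq 0$, $C_i$ is the set of vertices $\gamma$ with $\min_{\alpha\in C}d(\alpha,\gamma)=i$; the covering radius $\rho$ is the largest $i$ with $C_i\neq\emptyset$. $\mathrm{Aut}(C)$ is the setwise stabiliser of $C$ in $\mathrm{Sym}(\Omega)$. $C$ is $2$-neighbour-transitive if $\rho\geq 2$ and $\mathrm{Aut}(C)$ is transitive on each of $C$, $C_1$, $C_2$. *)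

theory Defs
  imports
    "HOL-Combinatorics.Permutations"
    "HOL-Algebra.Group_Action"
    "Graph_Theory.Graph_Theory"
begin

text \<open>An undirected graph is a symmetric digraph, as in \<open>Graph_Theory\<close>.\<close>

definition kneser :: "'a set \<Rightarrow> nat \<Rightarrow> 'a set pair_pre_digraph" where
  "kneser \<Omega> k =
    \<lparr> pverts = {A. A \<subseteq> \<Omega> \<and> card A = k},
      parcs = {(A, B). A \<subseteq> \<Omega> \<and> card A = k \<and> B \<subseteq> \<Omega> \<and> card B = k \<and> A \<inter> B = {}} \<rparr>"

text \<open>With all arcs of weight 1 the cost of a walk is its length, so \<open>\<mu>\<close> is the
  graph distance (\<open>\<infinity>\<close> between different components).\<close>

definition gdist :: "'v pair_pre_digraph \<Rightarrow> 'v \<Rightarrow> 'v \<Rightarrow> ereal" where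
  "gdist G u v = wf_digraph.\<mu> (with_proj G) (\<lambda>_. 1) u v"

definition is_code :: "'v pair_pre_digraph \<Rightarrow> 'v set \<Rightarrow> bool" where
  "is_code G C \<longleftrightarrow> C \<subseteq> pverts G \<and> card C \<ge> 2"

definition min_distance :: "'v pair_pre_digraph \<Rightarrow> 'v set \<Rightarrow> ereal" where
  "min_distance G C = Min {gdist G \<alpha> \<beta> | \<alpha> \<beta>. \<alpha> \<in> C \<and> \<beta> \<in> C \<and> \<alpha> \<noteq> \<beta>}"

definition dist_cell :: "'v pair_pre_digraph \<Rightarrow> 'v set \<Rightarrow> nat \<Rightarrow> 'v set" where
  "dist_cell G C i =
    {\<gamma> \<in> pverts G. Min ((\<lambda>\<alpha>. gdist G \<alpha> \<gamma>) ` C) = ereal (real i)}"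

definition covering_radius :: "'v pair_pre_digraph \<Rightarrow> 'v set \<Rightarrow> nat" where
  "covering_radius G C = Max {i. dist_cell G C i \<noteq> {}}"

text \<open>The setwise stabiliser of \<open>C\<close> in \<open>Sym(\<Omega>)\<close>, where a permutation acts on
  subsets of \<open>\<Omega>\<close> by taking images.\<close>

definition code_aut :: "'a set \<Rightarrow> 'a set set \<Rightarrow> ('a \<Rightarrow> 'a) monoid" where
  "code_aut \<Omega> C =
    \<lparr> carrier = {g. g permutes \<Omega> \<and> (`) g ` C = C}, monoid.mult = (\<circ>), one = id \<rparr>"

definition transitive_on_subsets :: "('a \<Rightarrow> 'a) monoid \<Rightarrow> 'a set set \<Rightarrow> bool" where
  "transitive_on_subsets G X \<longleftrightarrow> transitive_action G X (\<lambda>g. restrict ((`) g) X)"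

definition two_neighbour_transitive :: "'a set \<Rightarrow> nat \<Rightarrow> 'a set set \<Rightarrow> bool" where
  "two_neighbour_transitive \<Omega> k C \<longleftrightarrow>
    covering_radius (kneser \<Omega> k) C \<ge> 2 \<and>
    transitive_on_subsets (code_aut \<Omega> C) C \<and>
    transitive_on_subsets (code_aut \<Omega> C) (dist_cell (kneser \<Omega> k) C 1) \<and>
    transitive_on_subsets (code_aut \<Omega> C) (dist_cell (kneser \<Omega> k) C 2)"

lemma group_code_aut: "group (code_aut \<Omega> C)"
proof (rule groupI)
  fix g assume g: "g \<in> carrier (code_aut \<Omega> C)"
  then have p: "g permutes \<Omega>" and C: "(`) g ` C = C" by (auto simp: code_aut_def)
  have "(`) (inv_into UNIV g) ` C = (`) (inv_into UNIV g) ` ((`) g ` C)" using C by simp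
  also have "\<dots> = C" using permutes_inverses(2)[OF p]
    by (simp add: image_image)
  finally have "inv_into UNIV g \<in> carrier (code_aut \<Omega> C)"
    using permutes_inv[OF p] by (simp add: code_aut_def)
  then show "\<exists>h\<in>carrier (code_aut \<Omega> C). h \<otimes>\<^bsub>code_aut \<Omega> C\<^esub> g = \<one>\<^bsub>code_aut \<Omega> C\<^esub>"
    using permutes_inv_o(2)[OF p] by (intro bexI[of _ "inv_into UNIV g"]) (auto simp: code_aut_def)
next
  fix g h assume "g \<in> carrier (code_aut \<Omega> C)" "h \<in> carrier (code_aut \<Omega> C)"
  moreover have "(`) (g \<circ> h) ` C = (`) g ` ((`) h ` C)"
    by (simp add: image_image image_comp)
  ultimately show "g \<otimes>\<^bsub>code_aut \<Omega> C\<^esub> h \<in> carrier (code_aut \<Omega> C)"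
    by (simp add: code_aut_def permutes_compose)
qed (auto simp: code_aut_def permutes_id comp_assoc)

text \<open>On an invariant family of subsets, the library notion of a transitive action
  is plain transitivity.\<close>

lemma transitive_on_subsets_code_aut_iff:
  assumes invariant: "\<And>g. g \<in> carrier (code_aut \<Omega> C) \<Longrightarrow> (`) g ` X = X"
  shows "transitive_on_subsets (code_aut \<Omega> C) X \<longleftrightarrow>
    (\<forall>A\<in>X. \<forall>B\<in>X. \<exists>g\<in>carrier (code_aut \<Omega> C). g ` A = B)"
proof -
  let ?G = "code_aut \<Omega> C" and ?\<phi> = "\<lambda>g. restrict ((`) g) X"
  have bij: "?\<phi> g \<in> Bij X" if "g \<in> carrier ?G" for g
  proof -
    have "inj g" using that by (auto simp: code_aut_def permutes_inj)
    then have "inj_on ((`) g) X" by (simp add: inj_on_def inj_image_eq_iff)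
    then show ?thesis using invariant[OF that] by (auto simp: Bij_def bij_betw_def)
  qed
  have "?\<phi> \<in> hom ?G (BijGroup X)"
  proof (rule homI)
    fix g h assume gh: "g \<in> carrier ?G" "h \<in> carrier ?G"
    have "?\<phi> (g \<circ> h) = compose X (?\<phi> g) (?\<phi> h)"
    proof
      fix A
      show "?\<phi> (g \<circ> h) A = compose X (?\<phi> g) (?\<phi> h) A"
      proof (cases "A \<in> X")
        case True
        then have "h ` A \<in> X" using invariant[OF gh(2)] by blast
        with True show ?thesis by (simp add: compose_def image_comp)
      qed (simp add: compose_def)
    qed
    then show "?\<phi> (g \<otimes>\<^bsub>?G\<^esub> h) = ?\<phi> g \<otimes>\<^bsub>BijGroup X\<^esub> ?\<phi> h"
      using bij gh by (simp add: BijGroup_def code_aut_def)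
  qed (use bij in \<open>simp add: BijGroup_def\<close>)
  then have "group_action ?G X ?\<phi>"
    by (simp add: group_action_def group_hom_def group_hom_axioms_def group_code_aut group_BijGroup)
  then show ?thesis
    by (simp add: transitive_on_subsets_def transitive_action_def transitive_action_axioms_def Ball_def)
qed

end

theory Submission
  imports Defs
begin

text \<open>
  Suppose $\delta \ge 5$ and let $\alpha$ be a codeword. Since $n \ge 2k + 2$, two $k$-subsets
  that differ in one or in two elements have a common neighbour. So $C_2$ contains a vertex
  $\gamma_1$ with $|\alpha \setminus \gamma_1| = 1$ and a vertex $\gamma_2$ with
  $|\alpha \setminus \gamma_2| = 2$. As $\delta \ge 5$, the codeword $\alpha$ is the only one
  within distance $2$ of either, so an automorphism of $C$ that maps $\gamma_1$ to $\gamma_2$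
  fixes $\alpha$, which is absurd. (For $k = 2$ the vertex $\gamma_2$ would be disjoint from $\alpha$;
  but then the whole graph has diameter $2$.)
\<close>

lemma pair_fin_digraph_kneser:
  assumes "finite \<Omega>"
  shows "pair_fin_digraph (kneser \<Omega> k)"
proof
  show "finite (pverts (kneser \<Omega> k))" using assms by (simp add: kneser_def)
  then have "finite (pverts (kneser \<Omega> k) \<times> pverts (kneser \<Omega> k))" by simp
  then show "finite (parcs (kneser \<Omega> k))"
    by (rule rev_finite_subset) (auto simp: kneser_def)
qed (auto simp: kneser_def)

context pair_fin_digraph
begin

text \<open>Finite distances are costs of walks, and these can be concatenated; an infinite summand
  makes the right-hand side infinite.\<close>

lemma gdist_triangle: "gdist G u w \<le> gdist G u v + gdist G v w"
proof -
  have attained: "\<exists>p. awalk x p y \<and> gdist G x y = ereal (awalk_cost (\<lambda>_. 1) p)"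
    if "gdist G x y \<noteq> \<infinity>" for x y
  proof -
    have "x \<rightarrow>\<^sup>*\<^bsub>with_proj G\<^esub> y" using that shortest_path_inf unfolding gdist_def by blast
    \<comment> \<open>Unit costs are nonnegative, so in a finite digraph the infimum defining
      \<open>\<mu>\<close> is attained, even by a path.\<close>
    from min_cost_awalk[OF this, of "\<lambda>_. 1"] show ?thesis
      unfolding gdist_def apath_def by auto
  qed
  have nonneg: "gdist G x y \<noteq> - \<infinity>" for x y
    using attained[of x y] by (cases "gdist G x y = \<infinity>") auto
  show ?thesis
  proof (cases "gdist G u v = \<infinity> \<or> gdist G v w = \<infinity>")
    case True
    then show ?thesis using nonneg by auto
  next
    case False
    then obtain p q where
      p: "awalk u p v" "gdist G u v = ereal (awalk_cost (\<lambda>_. 1) p)" and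
      q: "awalk v q w" "gdist G v w = ereal (awalk_cost (\<lambda>_. 1) q)"
      using attained by meson
    have "awalk u (p @ q) w" using p q by (blast intro: awalk_appendI)
    from min_cost_le_walk_cost[OF this, of "\<lambda>_. 1"] show ?thesis
      using p q by (simp add: gdist_def)
  qed
qed

lemma gdist_le_2_if_common_neighbour:
  assumes "(u, v) \<in> parcs G" "(v, w) \<in> parcs G"
  shows "gdist G u w \<le> 2"
proof -
  have "awalk u [(u, v), (v, w)] w"
    using assms by (auto simp: awalk_simps dest: wellformed')
  from min_cost_le_walk_cost[OF this, of "\<lambda>_. 1"] show ?thesis by (simp add: gdist_def)
qed

lemma gdist_ge_2_if_not_adjacent:
  assumes "u \<noteq> v" "(u, v) \<notin> parcs G"
  shows "2 \<le> gdist G u v"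
  unfolding gdist_def \<mu>_def
proof (rule INF_greatest)
  fix p assume "p \<in> {p. awalk u p v}"
  then have p: "awalk u p v" by simp
  have "2 \<le> length p"
  proof (rule ccontr)
    assume "\<not> 2 \<le> length p"
    \<comment> \<open>The empty walk would force \<open>u = v\<close>, and a single arc would make
      \<open>u\<close> and \<open>v\<close> adjacent.\<close>
    then have "p = [] \<or> (\<exists>e. p = [e])" by (cases p; cases "tl p") auto
    then show False using p assms by (auto simp: awalk_simps)
  qed
  then show "2 \<le> ereal (awalk_cost (\<lambda>_. 1) p)"
    by (simp add: awalk_cost_def sum_list_triv)
qed

end

text \<open>The complement of \<open>A \<union> B\<close> has room for a \<open>k\<close>-subset,
  which is adjacent to both vertices.\<close>

lemma kneser_gdist_le_2:
  assumes "finite \<Omega>" "A \<in> pverts (kneser \<Omega> k)" "B \<in> pverts (kneser \<Omega> k)"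
    and "card (A \<union> B) + k \<le> card \<Omega>"
  shows "gdist (kneser \<Omega> k) A B \<le> 2"
proof -
  interpret pair_fin_digraph "kneser \<Omega> k" by (rule pair_fin_digraph_kneser) fact
  have AB: "A \<union> B \<subseteq> \<Omega>" using assms by (auto simp: kneser_def)
  have "card (\<Omega> - (A \<union> B)) = card \<Omega> - card (A \<union> B)"
    by (rule card_Diff_subset[OF finite_subset[OF AB assms(1)] AB])
  then have "k \<le> card (\<Omega> - (A \<union> B))" using assms(4) by simp
  then obtain D where "D \<subseteq> \<Omega> - (A \<union> B)" "card D = k"
    by (meson obtain_subset_with_card_n)
  then show ?thesis
    using assms by (intro gdist_le_2_if_common_neighbour[of A D B]) (auto simp: kneser_def)
qed

lemma min_distance_le:
  assumes "finite C" "\<alpha> \<in> C" "\<beta> \<in> C" "\<alpha> \<noteq> \<beta>"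
  shows "min_distance G C \<le> gdist G \<alpha> \<beta>"
proof -
  \<comment> \<open>\<open>Min\<close> is a lower bound only for a finite set, so finiteness is
    derived from that of \<open>C \<times> C\<close>.\<close>
  have "{gdist G \<alpha> \<beta> |\<alpha> \<beta>. \<alpha> \<in> C \<and> \<beta> \<in> C \<and> \<alpha> \<noteq> \<beta>} \<subseteq> (\<lambda>(\<alpha>, \<beta>). gdist G \<alpha> \<beta>) ` (C \<times> C)"
    by auto
  then have "finite {gdist G \<alpha> \<beta> |\<alpha> \<beta>. \<alpha> \<in> C \<and> \<beta> \<in> C \<and> \<alpha> \<noteq> \<beta>}"
    using assms(1) by (meson finite_SigmaI finite_imageI finite_subset)
  then show ?thesis unfolding min_distance_def using assms by (auto intro!: Min_le)
qed

text \<open>Going through \<open>\<gamma>\<close> costs at most 2 + 2 < 5. The two distances are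
  directed along the route from \<open>\<alpha>\<close> to \<open>\<beta>\<close>, so the triangle
  inequality applies without symmetry of \<open>gdist\<close>.\<close>

lemma unique_codeword_within_2:
  assumes "finite \<Omega>" "finite C" "5 \<le> min_distance (kneser \<Omega> k) C"
    and "\<alpha> \<in> C" "\<beta> \<in> C"
    and "gdist (kneser \<Omega> k) \<alpha> \<gamma> \<le> 2" "gdist (kneser \<Omega> k) \<gamma> \<beta> \<le> 2"
  shows "\<alpha> = \<beta>"
proof (rule ccontr)
  interpret pair_fin_digraph "kneser \<Omega> k" by (rule pair_fin_digraph_kneser) fact
  assume "\<alpha> \<noteq> \<beta>"
  then have "5 \<le> gdist (kneser \<Omega> k) \<alpha> \<beta>"
    by (rule order.trans[OF assms(3) min_distance_le[OF assms(2,4,5)]])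
  also have "\<dots> \<le> gdist (kneser \<Omega> k) \<alpha> \<gamma> + gdist (kneser \<Omega> k) \<gamma> \<beta>"
    by (rule gdist_triangle)
  also have "\<dots> \<le> 2 + 2" using assms by (intro add_mono)
  finally show False by simp
qed

text \<open>Two intersecting vertices are not adjacent, so \<open>\<alpha>\<close> is at distance
  exactly 2 from \<open>\<gamma>\<close>; the minimum distance keeps every other codeword further
  away.\<close>

lemma mem_dist_cell_2:
  assumes "finite \<Omega>" "C \<subseteq> pverts (kneser \<Omega> k)" "5 \<le> min_distance (kneser \<Omega> k) C"
    and "\<alpha> \<in> C" "\<gamma> \<in> pverts (kneser \<Omega> k)" "\<gamma> \<noteq> \<alpha>" "\<alpha> \<inter> \<gamma> \<noteq> {}"
    and union: "card (\<alpha> \<union> \<gamma>) + k \<le> card \<Omega>"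
  shows "\<gamma> \<in> dist_cell (kneser \<Omega> k) C 2"
proof -
  interpret pair_fin_digraph "kneser \<Omega> k" by (rule pair_fin_digraph_kneser) fact
  have fin: "finite C" using assms(2) pair_finite_verts finite_subset by blast
  have le: "gdist (kneser \<Omega> k) \<alpha> \<gamma> \<le> 2" "gdist (kneser \<Omega> k) \<gamma> \<alpha> \<le> 2"
    using kneser_gdist_le_2[OF assms(1), of \<alpha> k \<gamma>] kneser_gdist_le_2[OF assms(1), of \<gamma> k \<alpha>]
      assms(2,4,5) union by (auto simp: Un_commute)
  have ge: "2 \<le> gdist (kneser \<Omega> k) \<alpha> \<gamma>"
    using assms(6,7) by (intro gdist_ge_2_if_not_adjacent) (auto simp: kneser_def)
  \<comment> \<open>A codeword within distance 2 of \<open>\<gamma>\<close> must be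
    \<open>\<alpha>\<close>, for which the bound is \<open>ge\<close>.\<close>
  have "2 \<le> gdist (kneser \<Omega> k) \<beta> \<gamma>" if "\<beta> \<in> C" for \<beta>
    using unique_codeword_within_2[OF assms(1) fin assms(3) that assms(4) _ le(2)] ge
    by (cases "gdist (kneser \<Omega> k) \<beta> \<gamma> \<le> 2") auto
  then have "Min ((\<lambda>\<beta>. gdist (kneser \<Omega> k) \<beta> \<gamma>) ` C) = 2"
    using fin assms(4) antisym[OF le(1) ge] by (intro Min_eqI) (auto intro: rev_image_eqI)
  then show ?thesis using assms(5) by (simp add: dist_cell_def)
qed

lemma transitive_on_subsetsD:
  assumes "transitive_on_subsets G X" "A \<in> X" "B \<in> X"
  obtains g where "g \<in> carrier G" "g ` A = B"
  using transitive_action.unique_orbit[OF assms(1)[unfolded transitive_on_subsets_def] assms(2,3)]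
    assms(2) that by auto

theorem theorem3p1:
  fixes \<Omega> :: "'a set" and n k :: nat
  assumes "finite \<Omega>" and "card \<Omega> = n"
    and "2 \<le> k" and "real k \<le> (real n - 1) / 2"
    and "real k \<noteq> (real n - 1) / 2"
  shows "\<not> (\<exists>C. is_code (kneser \<Omega> k) C \<and> two_neighbour_transitive \<Omega> k C \<and>
    min_distance (kneser \<Omega> k) C \<ge> 5)"
proof
  assume "\<exists>C. is_code (kneser \<Omega> k) C \<and> two_neighbour_transitive \<Omega> k C \<and>
    min_distance (kneser \<Omega> k) C \<ge> 5"
  then obtain C where C: "C \<subseteq> pverts (kneser \<Omega> k)" "2 \<le> card C"
    and trans: "transitive_on_subsets (code_aut \<Omega> C) (dist_cell (kneser \<Omega> k) C 2)"
    and \<delta>: "5 \<le> min_distance (kneser \<Omega> k) C"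
    by (auto simp: is_code_def two_neighbour_transitive_def)
  \<comment> \<open>The bound on \<open>k\<close> is strict, so 2k + 1 < n. The extra element lets a
    union of size k + 2 still leave room for a common neighbour.\<close>
  have n: "2 * k + 2 \<le> card \<Omega>" using assms by (simp add: field_simps)
  have fin: "finite C" using C(2) by (cases "finite C") auto
  have vertex: "A \<subseteq> \<Omega> \<and> card A = k \<and> finite A" if "A \<in> pverts (kneser \<Omega> k)" for A
    using that assms(1) finite_subset by (auto simp: kneser_def)
  obtain \<alpha> \<beta> where \<alpha>: "\<alpha> \<in> C" and \<beta>: "\<beta> \<in> C" and "\<alpha> \<noteq> \<beta>"
    using C(2) by (auto simp: numeral_2_eq_2 card_le_Suc_iff)
  have \<alpha>V: "\<alpha> \<subseteq> \<Omega>" "card \<alpha> = k" "finite \<alpha>" using vertex \<alpha> C by auto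
  have "k \<noteq> 2"
  proof
    assume "k = 2"
    have "card (\<alpha> \<union> \<beta>) \<le> k + k"
      using card_Un_le[of \<alpha> \<beta>] vertex \<alpha> \<beta> C by (metis subsetD)
    \<comment> \<open>For k = 2 the total 3k equals 2k + 2.\<close>
    then have "card (\<alpha> \<union> \<beta>) + k \<le> card \<Omega>" using n \<open>k = 2\<close> by simp
    then have "gdist (kneser \<Omega> k) \<alpha> \<beta> \<le> 2"
      using \<alpha> \<beta> C assms(1) by (intro kneser_gdist_le_2) auto
    then have "min_distance (kneser \<Omega> k) C \<le> 2"
      using min_distance_le[OF fin \<alpha> \<beta> \<open>\<alpha> \<noteq> \<beta>\<close>] by (rule order.trans[rotated])
    with \<delta> have "(5::ereal) \<le> 2" by (rule order_trans)
    then show False by simp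
  qed
  then have k: "3 \<le> k" using assms(3) by simp
  \<comment> \<open>The elements of \<open>S\<close> are to be removed from \<open>\<alpha>\<close>
    and those of \<open>T\<close> put in their place: one exchange gives
    \<open>\<gamma>\<^sub>1\<close>, both give \<open>\<gamma>\<^sub>2\<close>.\<close>
  obtain S where S: "S \<subseteq> \<alpha>" "card S = 2"
    using \<alpha>V assms(3) by (metis obtain_subset_with_card_n)
  have "card (\<Omega> - \<alpha>) = card \<Omega> - k" using \<alpha>V by (simp add: card_Diff_subset)
  then have "2 \<le> card (\<Omega> - \<alpha>)" using n by simp
  then obtain T where T: "T \<subseteq> \<Omega> - \<alpha>" "card T = 2"
    by (metis obtain_subset_with_card_n)
  obtain x y where xy: "S = {x, y}" "x \<noteq> y" using S(2) by (auto simp: card_2_iff)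
  obtain z w where zw: "T = {z, w}" "z \<noteq> w" using T(2) by (auto simp: card_2_iff)
  define \<gamma>\<^sub>1 where "\<gamma>\<^sub>1 = (\<alpha> - {x}) \<union> {z}"
  define \<gamma>\<^sub>2 where "\<gamma>\<^sub>2 = (\<alpha> - {x, y}) \<union> {z, w}"
  have mem: "x \<in> \<alpha>" "y \<in> \<alpha>" "z \<in> \<Omega>" "w \<in> \<Omega>" "z \<notin> \<alpha>" "w \<notin> \<alpha>"
    using S T xy zw by auto
  have union1: "\<alpha> \<union> \<gamma>\<^sub>1 = insert z \<alpha>" and union2: "\<alpha> \<union> \<gamma>\<^sub>2 = insert z (insert w \<alpha>)"
    by (auto simp: \<gamma>\<^sub>1_def \<gamma>\<^sub>2_def)
  have inter1: "\<alpha> \<inter> \<gamma>\<^sub>1 = \<alpha> - {x}" and inter2: "\<alpha> \<inter> \<gamma>\<^sub>2 = \<alpha> - {x, y}"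
    using mem by (auto simp: \<gamma>\<^sub>1_def \<gamma>\<^sub>2_def)
  have card_inter: "card (\<alpha> \<inter> \<gamma>\<^sub>1) = k - 1" "card (\<alpha> \<inter> \<gamma>\<^sub>2) = k - 2"
    unfolding inter1 inter2 using mem xy \<alpha>V by (simp_all add: card_Diff_subset)
  have card_union: "card (\<alpha> \<union> \<gamma>\<^sub>1) = k + 1" "card (\<alpha> \<union> \<gamma>\<^sub>2) = k + 2"
    unfolding union1 union2 using mem zw \<alpha>V by simp_all
  \<comment> \<open>Inclusion-exclusion: both (k + 1) + (k - 1) and (k + 2) + (k - 2) equal
    2k.\<close>
  have "card \<gamma>\<^sub>1 = k" "card \<gamma>\<^sub>2 = k"
    using card_Un_Int[of \<alpha> \<gamma>\<^sub>1] card_Un_Int[of \<alpha> \<gamma>\<^sub>2] card_inter card_union k \<alpha>V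
    by (auto simp: \<gamma>\<^sub>1_def \<gamma>\<^sub>2_def)
  then have \<gamma>V: "\<gamma>\<^sub>1 \<in> pverts (kneser \<Omega> k)" "\<gamma>\<^sub>2 \<in> pverts (kneser \<Omega> k)"
    using mem \<alpha>V by (auto simp: kneser_def \<gamma>\<^sub>1_def \<gamma>\<^sub>2_def)
  \<comment> \<open>Here k \<ge> 3 matters: the intersection with \<open>\<gamma>\<^sub>2\<close>
    has k - 2 elements.\<close>
  have nonempty: "\<alpha> \<inter> \<gamma>\<^sub>1 \<noteq> {}" "\<alpha> \<inter> \<gamma>\<^sub>2 \<noteq> {}"
    using card_inter k by (auto intro: ccontr)
  have "\<gamma>\<^sub>1 \<noteq> \<alpha>" "\<gamma>\<^sub>2 \<noteq> \<alpha>" using mem by (auto simp: \<gamma>\<^sub>1_def \<gamma>\<^sub>2_def)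
  then have cell: "\<gamma>\<^sub>1 \<in> dist_cell (kneser \<Omega> k) C 2" "\<gamma>\<^sub>2 \<in> dist_cell (kneser \<Omega> k) C 2"
    using mem_dist_cell_2[OF assms(1) C(1) \<delta> \<alpha>] \<gamma>V nonempty card_union n by auto
  obtain g where g: "g permutes \<Omega>" "(`) g ` C = C" "g ` \<gamma>\<^sub>1 = \<gamma>\<^sub>2"
    by (rule transitive_on_subsetsD[OF trans cell]) (auto simp: code_aut_def)
  have g\<alpha>: "g ` \<alpha> \<in> C" using \<alpha> g(2) by blast
  have "inj g" using g(1) by (rule permutes_inj)
  then have "card (g ` \<alpha> \<union> \<gamma>\<^sub>2) = k + 1" and inter: "card (g ` \<alpha> \<inter> \<gamma>\<^sub>2) = k - 1"
    unfolding g(3)[symmetric] image_Un[symmetric] image_Int[symmetric]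
    using card_union card_inter by (simp_all add: image_Int[symmetric] card_image inj_on_subset)
  then have "gdist (kneser \<Omega> k) (g ` \<alpha>) \<gamma>\<^sub>2 \<le> 2"
    using g\<alpha> C \<gamma>V n assms(1) by (intro kneser_gdist_le_2) auto
  moreover have "gdist (kneser \<Omega> k) \<gamma>\<^sub>2 \<alpha> \<le> 2"
    using \<alpha> C \<gamma>V n card_union assms(1) by (intro kneser_gdist_le_2) (auto simp: Un_commute)
  ultimately have "g ` \<alpha> = \<alpha>"
    using unique_codeword_within_2[OF assms(1) fin \<delta> g\<alpha> \<alpha>] by blast
  \<comment> \<open>The intersection of \<open>\<alpha>\<close> with \<open>\<gamma>\<^sub>2\<close>
    would have both k - 1 and k - 2 elements.\<close>
  then show False using inter card_inter(2) k by simp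
qed

end
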